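(* For every $\alpha > 0$ and $0 < p < 1$ there exists $N_{\alpha,p}$ such that no cooperative Boolean network of dimension $N \ge N_{\alpha,p}$ can have the property that for some fixed time $t>0$, with probability $\ge p$, a single-bit flip $\vec{s}^{\,*}(0)$ in a randomly chosen initial condition $\vec{s}(0)$ leads to trajectories with $H(\vec{s}(t),\vec{s}^{\,*}(t))\ge \alpha N$. In particular, for any $q>0$, no cooperative Boolean network of sufficiently large dimension (depending on $\alpha,p,q$) can exhibit $p$-$\alpha$-$q$-decoherence.
   Context: Write $[N]=\{1,\dots,N\}$. An $N$-dimensional Boolean network is a pair $(2^{[N]},f)$ with $f:\{0,1\}^{[N]}\to\{0,1\}^{[N]}$; it is updated synchronously in discrete time by $\vec{s}(t+1)=f(\vec{s}(t))$, $t=0,1,2,\dots$. The network is cooperative if $\vec{s}\le\vec{s}^{\,*}$ coordinatewise implies $f(\vec{s})\le f(\vec{s}^{\,*})$ coordinatewise. The Hamming distance $H(\vec{s},\vec{s}^{\,*})$ is the number of coordinates in which $\vec{s}$ and $\vec{s}^{\,*}$ differ. A randomly chosen initial condition is uniformly distributed on $\{0,1\}^{[N]}$; the single-bit flip is random: it changes the value of one coordinate chosen uniformly from $[N]$, independently of the state. Probabilities are taken over the pair (initial condition, flipped coordinate). The network exhibits $p$-$\alpha$-$q$-decoherence if with probability $\ge p$ a random one-bit flip $\vec{s}^{\,*}(0)$ in a randomly chosen initial condition $\vec{s}(0)$ results in trajectories with the property that for all sufficiently large $t^*>0$, the proportion of (integer) times $t\in[0,t^*]$ for which $H(\vec{s}(t),\vec{s}^{\,*}(t))\ge\alpha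 N$ is at least $q$. *)

theory Defs
  imports "HOL-Probability.Probability" "HOL-Library.FuncSet"
begin

text \<open>The state space \<open>{0,1}^[N]\<close>, with \<open>False < True\<close> as the two values.  States are
  extensional (\<open>undefined\<close> outside \<open>[N]\<close>), so that the set is finite with \<open>2^N\<close> elements.\<close>

definition bstates :: "nat \<Rightarrow> (nat \<Rightarrow> bool) set" where
  "bstates N = {1..N} \<rightarrow>\<^sub>E UNIV"

text \<open>Values of \<open>f\<close> outside \<open>bstates N\<close> are irrelevant.\<close>

definition boolean_network :: "nat \<Rightarrow> ((nat \<Rightarrow> bool) \<Rightarrow> (nat \<Rightarrow> bool)) \<Rightarrow> bool" where
  "boolean_network N f \<longleftrightarrow> f \<in> bstates N \<rightarrow> bstates N"

definition state_le :: "nat \<Rightarrow> (nat \<Rightarrow> bool) \<Rightarrow> (nat \<Rightarrow> bool) \<Rightarrow> bool" where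
  "state_le N s s' \<longleftrightarrow> (\<forall>i\<in>{1..N}. s i \<le> s' i)"

definition cooperative :: "nat \<Rightarrow> ((nat \<Rightarrow> bool) \<Rightarrow> (nat \<Rightarrow> bool)) \<Rightarrow> bool" where
  "cooperative N f \<longleftrightarrow>
     (\<forall>s\<in>bstates N. \<forall>s'\<in>bstates N. state_le N s s' \<longrightarrow> state_le N (f s) (f s'))"

definition hamming :: "nat \<Rightarrow> (nat \<Rightarrow> bool) \<Rightarrow> (nat \<Rightarrow> bool) \<Rightarrow> nat" where
  "hamming N s s' = card {i\<in>{1..N}. s i \<noteq> s' i}"

definition trajectory ::
  "((nat \<Rightarrow> bool) \<Rightarrow> (nat \<Rightarrow> bool)) \<Rightarrow> (nat \<Rightarrow> bool) \<Rightarrow> nat \<Rightarrow> (nat \<Rightarrow> bool)" where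
  "trajectory f s t = (f ^^ t) s"

definition bit_flip :: "nat \<Rightarrow> (nat \<Rightarrow> bool) \<Rightarrow> (nat \<Rightarrow> bool)" where
  "bit_flip i s = s(i := \<not> s i)"

text \<open>The joint law of a random initial condition and an independent random coordinate to be
  flipped.  It is meaningful only for \<open>N \<ge> 1\<close>, since \<open>pmf_of_set\<close> is unspecified on the
  empty set.\<close>

definition init_flip_pmf :: "nat \<Rightarrow> ((nat \<Rightarrow> bool) \<times> nat) pmf" where
  "init_flip_pmf N = pair_pmf (pmf_of_set (bstates N)) (pmf_of_set {1..N})"

definition flip_distance ::
  "nat \<Rightarrow> ((nat \<Rightarrow> bool) \<Rightarrow> (nat \<Rightarrow> bool)) \<Rightarrow> (nat \<Rightarrow> bool) \<Rightarrow> nat \<Rightarrow> nat \<Rightarrow> nat" where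
  "flip_distance N f s i t = hamming N (trajectory f s t) (trajectory f (bit_flip i s) t)"

text \<open>The integer times in \<open>[0,T]\<close> are the \<open>T + 1\<close> elements of \<open>{0..T}\<close>.\<close>

definition time_proportion :: "(nat \<Rightarrow> bool) \<Rightarrow> nat \<Rightarrow> real" where
  "time_proportion P T = real (card {t\<in>{0..T}. P t}) / real (card {0..T})"

definition decoherent ::
  "real \<Rightarrow> real \<Rightarrow> real \<Rightarrow> nat \<Rightarrow> ((nat \<Rightarrow> bool) \<Rightarrow> (nat \<Rightarrow> bool)) \<Rightarrow> bool" where
  "decoherent p \<alpha> q N f \<longleftrightarrow>
     measure_pmf.prob (init_flip_pmf N)
       {(s, i). \<forall>\<^sub>F T in sequentially.
          time_proportion (\<lambda>t. real (flip_distance N f s i t) \<ge> \<alpha> * real N) T \<ge> q} \<ge> p"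

end

theory Submission
  imports Defs "HOL-Real_Asymp.Real_Asymp"
begin

text \<open>The reason is that a monotone Boolean function on \<open>{0,1}^N\<close> has total influence at most
  \<open>sqrt N\<close>: on average over the initial condition, at most \<open>sqrt N\<close> of the \<open>N\<close> possible bit
  flips change its value.  Indeed, write bits as spins \<open>\<plusminus>1\<close>.  For a monotone \<open>g\<close> with values
  \<open>\<plusminus>1\<close>, the influence of coordinate \<open>i\<close> is the correlation of \<open>g\<close> with the spin \<open>i\<close>, so the total
  influence is the correlation of \<open>g\<close> with the magnetization, the sum of all spins
  (\<open>influence_eq_spin_correlation\<close>).  It is therefore at most the mean absolute value of the
  magnetization, and since distinct spins are uncorrelated, the second moment of the
  magnetization is \<open>N\<close> (\<open>magnetization_second_moment\<close>).

  In a cooperative network every coordinate of the state at time \<open>t\<close> is a monotone function of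
  the initial condition, whatever \<open>t\<close> is.  Adding up the \<open>N\<close> total influences and dividing by the
  number \<open>N\<close> of possible flips shows that the expected Hamming distance at time \<open>t\<close> is at most
  \<open>sqrt N\<close>.  By Markov's inequality it reaches \<open>\<alpha> N\<close> with probability at most
  \<open>1 / (\<alpha> sqrt N)\<close>, uniformly in \<open>t\<close> (\<open>prob_flip_distance_le\<close>), and this tends to \<open>0\<close>.  For
  decoherence, the uniformity in \<open>t\<close> allows averaging over a long time window: the expected
  proportion of times with large distance obeys the same bound, yet it is at least \<open>p q\<close>.\<close>

section \<open>The Boolean cube and its spins\<close>

lemma finite_bstates [simp]: "finite (bstates N)"
  by (simp add: bstates_def finite_PiE)

lemma bstates_nonempty [simp]: "bstates N \<noteq> {}"
  by (simp add: bstates_def PiE_eq_empty_iff)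

lemma bit_flip_bit_flip [simp]: "bit_flip i (bit_flip i s) = s"
  by (auto simp: bit_flip_def)

lemma bit_flip_in_bstates: "i \<in> {1..N} \<Longrightarrow> s \<in> bstates N \<Longrightarrow> bit_flip i s \<in> bstates N"
  by (auto simp: bstates_def bit_flip_def PiE_def extensional_def)

lemma sum_bit_flip:
  assumes "i \<in> {1..N}"
  shows "(\<Sum>s\<in>bstates N. h (bit_flip i s)) = (\<Sum>s\<in>bstates N. h s)"
  by (rule sum.reindex_bij_witness[where i = "bit_flip i" and j = "bit_flip i"])
     (use assms in \<open>auto intro: bit_flip_in_bstates\<close>)

definition spin :: "nat \<Rightarrow> (nat \<Rightarrow> bool) \<Rightarrow> real" where
  "spin i s = (if s i then 1 else -1)"

lemma spin_bit_flip: "spin j (bit_flip i s) = (if i = j then - spin j s else spin j s)"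
  by (auto simp: spin_def bit_flip_def)

lemma spin_square: "spin i s * spin i s = 1"
  by (simp add: spin_def)

text \<open>Flipping the bit \<open>i\<close> preserves the uniform measure and reverses the sign of the product, so
  the sum equals its own negative.\<close>

lemma spin_orthogonal:
  assumes "i \<in> {1..N}" and "i \<noteq> j"
  shows "(\<Sum>s\<in>bstates N. spin i s * spin j s) = 0"
  using sum_bit_flip[OF assms(1), of "\<lambda>s. spin i s * spin j s"] assms(2)
  by (simp add: spin_bit_flip sum_negf)

lemma magnetization_second_moment:
  "(\<Sum>s\<in>bstates N. (\<Sum>i\<in>{1..N}. spin i s)\<^sup>2) = real N * real (card (bstates N))"
proof -
  have "(\<Sum>s\<in>bstates N. (\<Sum>i\<in>{1..N}. spin i s)\<^sup>2)
      = (\<Sum>s\<in>bstates N. \<Sum>i\<in>{1..N}. \<Sum>j\<in>{1..N}. spin i s * spin j s)"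
    by (simp add: power2_eq_square sum_product)
  also have "\<dots> = (\<Sum>i\<in>{1..N}. \<Sum>s\<in>bstates N. \<Sum>j\<in>{1..N}. spin i s * spin j s)"
    by (rule sum.swap)
  also have "\<dots> = (\<Sum>i\<in>{1..N}. \<Sum>j\<in>{1..N}. \<Sum>s\<in>bstates N. spin i s * spin j s)"
    by (intro sum.cong refl sum.swap)
  also have "\<dots> = (\<Sum>i\<in>{1..N}. \<Sum>j\<in>{1..N}. if i = j then real (card (bstates N)) else 0)"
    by (intro sum.cong refl) (auto simp: spin_square spin_orthogonal)
  finally show ?thesis by simp
qed

section \<open>The total influence of a monotone function\<close>

definition monotone_on_cube :: "nat \<Rightarrow> ((nat \<Rightarrow> bool) \<Rightarrow> bool) \<Rightarrow> bool" where
  "monotone_on_cube N g \<longleftrightarrow>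
     (\<forall>s\<in>bstates N. \<forall>s'\<in>bstates N. state_le N s s' \<longrightarrow> g s \<le> g s')"

text \<open>Pairing \<open>s\<close> with \<open>bit_flip i s\<close> turns the correlation into a sum of discrete derivatives
  of \<open>g\<close> in direction \<open>i\<close>.  Monotonicity is what makes every derivative nonnegative, so that it
  coincides with its absolute value, which for values \<open>\<plusminus>1\<close> is twice the indicator that the flip
  matters; the factor is absorbed because the pairing counts every state twice.\<close>

lemma influence_eq_spin_correlation:
  assumes g: "monotone_on_cube N g" and i: "i \<in> {1..N}"
  shows "(\<Sum>s\<in>bstates N. of_bool (g s \<noteq> g (bit_flip i s)))
       = (\<Sum>s\<in>bstates N. spin i s * (if g s then 1 else -1))"
proof -
  define G :: "(nat \<Rightarrow> bool) \<Rightarrow> real" where "G s = (if g s then 1 else -1)" for s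
  have pointwise: "spin i s * (G s - G (bit_flip i s)) = 2 * of_bool (g s \<noteq> g (bit_flip i s))"
    if s: "s \<in> bstates N" for s
  proof -
    have flip: "bit_flip i s \<in> bstates N" using i s by (rule bit_flip_in_bstates)
    show ?thesis
    proof (cases "s i")
      case True
      then have "state_le N (bit_flip i s) s" by (auto simp: state_le_def bit_flip_def)
      then have "g (bit_flip i s) \<le> g s" using g s flip by (auto simp: monotone_on_cube_def)
      then show ?thesis using True by (auto simp: spin_def G_def)
    next
      case False
      then have "state_le N s (bit_flip i s)" by (auto simp: state_le_def bit_flip_def)
      then have "g s \<le> g (bit_flip i s)" using g s flip by (auto simp: monotone_on_cube_def)
      then show ?thesis using False by (auto simp: spin_def G_def)
    qed
  qed
  have "(\<Sum>s\<in>bstates N. spin i s * G s) = - (\<Sum>s\<in>bstates N. spin i s * G (bit_flip i s))"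
    using sum_bit_flip[OF i, of "\<lambda>s. spin i s * G s"] by (simp add: spin_bit_flip sum_negf)
  then have "2 * (\<Sum>s\<in>bstates N. spin i s * G s)
      = (\<Sum>s\<in>bstates N. spin i s * (G s - G (bit_flip i s)))"
    by (simp add: right_diff_distrib sum_subtractf)
  also have "\<dots> = 2 * (\<Sum>s\<in>bstates N. of_bool (g s \<noteq> g (bit_flip i s)))"
    by (simp add: pointwise sum_distrib_left)
  finally show ?thesis by (simp add: G_def)
qed

text \<open>The first absolute moment of the magnetization \<open>X\<close> is bounded through its second moment by
  the pointwise inequality \<open>2 |X| \<le> X\<^sup>2 / sqrt N + sqrt N\<close>, which is tight when \<open>X\<^sup>2\<close> takes its
  mean value \<open>N\<close> and so loses nothing against the Cauchy-Schwarz inequality.\<close>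

lemma total_influence_le:
  assumes g: "monotone_on_cube N g" and N: "N \<ge> 1"
  shows "(\<Sum>s\<in>bstates N. \<Sum>i\<in>{1..N}. of_bool (g s \<noteq> g (bit_flip i s)))
       \<le> sqrt (real N) * real (card (bstates N))"
proof -
  let ?r = "sqrt (real N)"
  define X where "X s = (\<Sum>i\<in>{1..N}. spin i s)" for s
  have r: "?r > 0" using N by simp
  have abs_le: "\<bar>x\<bar> \<le> (x\<^sup>2 / c + c) / 2" if "c > 0" for x c :: real
  proof -
    have "0 \<le> (\<bar>x\<bar> - c)\<^sup>2" by simp
    also have "(\<bar>x\<bar> - c)\<^sup>2 = x\<^sup>2 + c\<^sup>2 - 2 * \<bar>x\<bar> * c"
      by (simp only: power2_diff power2_abs)
    finally show ?thesis
      using that by (simp add: field_simps power2_eq_square)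
  qed
  have "(\<Sum>s\<in>bstates N. \<Sum>i\<in>{1..N}. of_bool (g s \<noteq> g (bit_flip i s)))
      = (\<Sum>i\<in>{1..N}. \<Sum>s\<in>bstates N. of_bool (g s \<noteq> g (bit_flip i s)) :: real)"
    by (rule sum.swap)
  also have "\<dots> = (\<Sum>i\<in>{1..N}. \<Sum>s\<in>bstates N. spin i s * (if g s then 1 else -1))"
    by (intro sum.cong refl influence_eq_spin_correlation g)
  also have "\<dots> = (\<Sum>s\<in>bstates N. \<Sum>i\<in>{1..N}. spin i s * (if g s then 1 else -1))"
    by (rule sum.swap)
  also have "\<dots> = (\<Sum>s\<in>bstates N. X s * (if g s then 1 else -1))"
    by (simp only: X_def sum_distrib_right)
  also have "\<dots> \<le> (\<Sum>s\<in>bstates N. ((X s)\<^sup>2 / ?r + ?r) / 2)"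
  proof (rule sum_mono)
    fix s
    have "X s * (if g s then 1 else -1) \<le> \<bar>X s\<bar>" by auto
    also note abs_le[OF r]
    finally show "X s * (if g s then 1 else -1) \<le> ((X s)\<^sup>2 / ?r + ?r) / 2" .
  qed
  also have "\<dots> = ((\<Sum>s\<in>bstates N. (X s)\<^sup>2) / ?r + ?r * real (card (bstates N))) / 2"
    by (simp add: sum_divide_distrib[symmetric] sum.distrib)
  also have "\<dots> = ?r * real (card (bstates N))"
    using r unfolding X_def magnetization_second_moment
    by (simp add: real_div_sqrt divide_simps)
  finally show ?thesis .
qed

section \<open>Damage spreading in cooperative networks\<close>

lemma trajectory_in_bstates:
  assumes "boolean_network N f" and "s \<in> bstates N"
  shows "trajectory f s t \<in> bstates N"
  using assms by (induction t) (auto simp: trajectory_def boolean_network_def)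

lemma trajectory_mono:
  assumes "boolean_network N f" and "cooperative N f"
    and "s \<in> bstates N" and "s' \<in> bstates N" and "state_le N s s'"
  shows "state_le N (trajectory f s t) (trajectory f s' t)"
proof (induction t)
  case 0
  then show ?case using assms by (simp add: trajectory_def)
next
  case (Suc t)
  then show ?case
    using assms trajectory_in_bstates[OF assms(1,3), of t] trajectory_in_bstates[OF assms(1,4), of t]
    by (auto simp: trajectory_def cooperative_def)
qed

lemma monotone_trajectory_coordinate:
  assumes "boolean_network N f" and "cooperative N f" and "j \<in> {1..N}"
  shows "monotone_on_cube N (\<lambda>s. trajectory f s t j)"
  unfolding monotone_on_cube_def
proof (intro ballI impI)
  fix s s'
  assume "s \<in> bstates N" "s' \<in> bstates N" "state_le N s s'"
  with assms have "state_le N (trajectory f s t) (trajectory f s' t)"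
    by (intro trajectory_mono)
  then show "trajectory f s t j \<le> trajectory f s' t j"
    using assms(3) by (simp only: state_le_def)
qed

lemma init_flip_pmf_eq:
  assumes "N \<ge> 1"
  shows "init_flip_pmf N = pmf_of_set (bstates N \<times> {1..N})"
proof (rule pmf_eqI)
  fix x :: "(nat \<Rightarrow> bool) \<times> nat"
  show "pmf (init_flip_pmf N) x = pmf (pmf_of_set (bstates N \<times> {1..N})) x"
    using assms
    by (cases x) (simp add: init_flip_pmf_def pmf_pair card_cartesian_product indicator_times)
qed

lemma prob_init_flip:
  assumes "N \<ge> 1"
  shows "measure_pmf.prob (init_flip_pmf N) A
       = real (card ((bstates N \<times> {1..N}) \<inter> A)) / (real (card (bstates N)) * real N)"
  using assms by (simp add: init_flip_pmf_eq measure_pmf_of_set card_cartesian_product)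

text \<open>The distance is a sum over coordinates \<open>j\<close> of the indicators that the flip \<open>i\<close> matters for
  coordinate \<open>j\<close>, so its sum over all initial conditions and flips is a sum of \<open>N\<close> total
  influences.\<close>

lemma sum_flip_distance_le:
  assumes f: "boolean_network N f" "cooperative N f" and N: "N \<ge> 1"
  shows "(\<Sum>(s, i)\<in>bstates N \<times> {1..N}. real (flip_distance N f s i t))
       \<le> real N * (sqrt (real N) * real (card (bstates N)))"
proof -
  let ?I = "\<lambda>j s i. of_bool (trajectory f s t j \<noteq> trajectory f (bit_flip i s) t j) :: real"
  have dist: "real (flip_distance N f s i t) = (\<Sum>j\<in>{1..N}. ?I j s i)" for s i
    by (simp add: flip_distance_def hamming_def Int_def)
  have "(\<Sum>(s, i)\<in>bstates N \<times> {1..N}. real (flip_distance N f s i t))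
      = (\<Sum>s\<in>bstates N. \<Sum>i\<in>{1..N}. \<Sum>j\<in>{1..N}. ?I j s i)"
    by (simp only: dist sum.cartesian_product[symmetric])
  also have "\<dots> = (\<Sum>s\<in>bstates N. \<Sum>j\<in>{1..N}. \<Sum>i\<in>{1..N}. ?I j s i)"
    by (intro sum.cong refl sum.swap)
  also have "\<dots> = (\<Sum>j\<in>{1..N}. \<Sum>s\<in>bstates N. \<Sum>i\<in>{1..N}. ?I j s i)"
    by (rule sum.swap)
  also have "\<dots> \<le> (\<Sum>j\<in>{1..N}. sqrt (real N) * real (card (bstates N)))"
    by (intro sum_mono total_influence_le monotone_trajectory_coordinate f N)
  finally show ?thesis by simp
qed

lemma prob_flip_distance_le:
  assumes f: "boolean_network N f" "cooperative N f" and N: "N \<ge> 1" and \<alpha>: "\<alpha> > 0"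
  shows "measure_pmf.prob (init_flip_pmf N)
           {(s, i). real (flip_distance N f s i t) \<ge> \<alpha> * real N} \<le> 1 / (\<alpha> * sqrt (real N))"
proof -
  define A where "A = {(s, i). real (flip_distance N f s i t) \<ge> \<alpha> * real N}"
  let ?\<Omega> = "bstates N \<times> {1..N}" and ?K = "real (card (bstates N))"
  have K: "?K > 0" by (simp add: card_gt_0_iff)
  have "\<alpha> * real N * real (card (?\<Omega> \<inter> A)) = (\<Sum>(s, i)\<in>?\<Omega> \<inter> A. \<alpha> * real N)"
    by (simp add: split_def)
  also have "\<dots> \<le> (\<Sum>(s, i)\<in>?\<Omega> \<inter> A. real (flip_distance N f s i t))"
    by (intro sum_mono) (auto simp: A_def)
  also have "\<dots> \<le> (\<Sum>(s, i)\<in>?\<Omega>. real (flip_distance N f s i t))"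
    by (intro sum_mono2) auto
  also have "\<dots> \<le> real N * (sqrt (real N) * ?K)"
    by (rule sum_flip_distance_le[OF f N])
  finally have "\<alpha> * real (card (?\<Omega> \<inter> A)) \<le> sqrt (real N) * ?K"
    using N by (simp add: mult.assoc mult.left_commute)
  then have "sqrt (real N) * (\<alpha> * real (card (?\<Omega> \<inter> A))) \<le> sqrt (real N) * (sqrt (real N) * ?K)"
    by (rule mult_left_mono) simp
  then have "\<alpha> * sqrt (real N) * real (card (?\<Omega> \<inter> A)) \<le> ?K * real N"
    by (simp add: mult_ac flip: mult.assoc)
  then have "real (card (?\<Omega> \<inter> A)) / (?K * real N) \<le> 1 / (\<alpha> * sqrt (real N))"
    using K N \<alpha> by (simp add: field_simps)
  then show ?thesis
    using prob_init_flip[OF N, of A] by (simp add: A_def)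
qed

text \<open>There are only finitely many pairs of an initial condition and a flip, so a single time
  horizon \<open>T\<close> works for all of them.  Up to that horizon, Markov's inequality for the proportion of
  damaged times and an exchange of the averages over time and over pairs reduce the claim to the
  bound at fixed times.\<close>

lemma decoherent_imp_le:
  assumes f: "boolean_network N f" "cooperative N f" and N: "N \<ge> 1" and \<alpha>: "\<alpha> > 0" and q: "q > 0"
    and dec: "decoherent p \<alpha> q N f"
  shows "p * q \<le> 1 / (\<alpha> * sqrt (real N))"
proof -
  let ?\<Omega> = "bstates N \<times> {1..N}" and ?b = "1 / (\<alpha> * sqrt (real N))"
  let ?c = "real (card (bstates N)) * real N"
  define A where "A t = {(s, i). real (flip_distance N f s i t) \<ge> \<alpha> * real N}" for t
  define freq where "freq w T = time_proportion (\<lambda>t. w \<in> A t) T" for w T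
  define D where "D = {w. \<forall>\<^sub>F T in sequentially. freq w T \<ge> q}"
  have c: "?c > 0" using N by (simp add: card_gt_0_iff)
  have "D = {(s, i). \<forall>\<^sub>F T in sequentially.
          time_proportion (\<lambda>t. real (flip_distance N f s i t) \<ge> \<alpha> * real N) T \<ge> q}"
    by (auto simp: D_def freq_def A_def)
  then have p: "p \<le> real (card (?\<Omega> \<inter> D)) / ?c"
    using dec prob_init_flip[OF N, of D] by (simp add: decoherent_def)
  have "\<forall>\<^sub>F T in sequentially. \<forall>w\<in>?\<Omega> \<inter> D. freq w T \<ge> q"
    by (rule eventually_ball_finite) (auto simp: D_def)
  then obtain T where T: "\<And>w. w \<in> ?\<Omega> \<inter> D \<Longrightarrow> freq w T \<ge> q"
    using eventually_happens'[OF sequentially_bot] by blast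
  have at_time: "real (card (?\<Omega> \<inter> A t)) \<le> ?b * ?c" for t
    using prob_flip_distance_le[OF f N \<alpha>, of t] prob_init_flip[OF N, of "A t"] c
    by (simp add: A_def pos_divide_le_eq)
  have freq_eq: "freq w T = (\<Sum>t\<in>{0..T}. of_bool (w \<in> A t)) / real (T + 1)" for w
    by (simp add: freq_def time_proportion_def Int_def)
  have "q * real (card (?\<Omega> \<inter> D)) = (\<Sum>w\<in>?\<Omega> \<inter> D. q)" by simp
  also have "\<dots> \<le> (\<Sum>w\<in>?\<Omega> \<inter> D. freq w T)"
    by (intro sum_mono T)
  also have "\<dots> \<le> (\<Sum>w\<in>?\<Omega>. freq w T)"
    by (intro sum_mono2) (auto simp: freq_def time_proportion_def)
  also have "\<dots> = (\<Sum>w\<in>?\<Omega>. \<Sum>t\<in>{0..T}. of_bool (w \<in> A t)) / real (T + 1)"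
    by (simp only: freq_eq sum_divide_distrib)
  also have "\<dots> = (\<Sum>t\<in>{0..T}. \<Sum>w\<in>?\<Omega>. of_bool (w \<in> A t)) / real (T + 1)"
    by (rule arg_cong[where f = "\<lambda>x. x / real (T + 1)"], rule sum.swap)
  also have "\<dots> = (\<Sum>t\<in>{0..T}. real (card (?\<Omega> \<inter> A t))) / real (T + 1)"
    by (simp add: Int_def)
  also have "\<dots> \<le> (\<Sum>t\<in>{0..T}. ?b * ?c) / real (T + 1)"
    by (intro divide_right_mono sum_mono at_time) simp
  also have "\<dots> = ?b * ?c" by simp
  finally have "real (card (?\<Omega> \<inter> D)) / ?c * q \<le> ?b"
    using c by (simp add: pos_divide_le_eq mult.commute)
  moreover have "p * q \<le> real (card (?\<Omega> \<inter> D)) / ?c * q"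
    using p q by (intro mult_right_mono) auto
  ultimately show ?thesis by linarith
qed

lemma eventually_inverse_sqrt_less:
  assumes "\<alpha> > 0" and "c > 0"
  obtains N0 :: nat where "\<And>N. N \<ge> N0 \<Longrightarrow> N \<ge> 1 \<and> 1 / (\<alpha> * sqrt (real N)) < c"
proof -
  have "(\<lambda>N::nat. 1 / (\<alpha> * sqrt (real N))) \<longlonglongrightarrow> 0"
    using assms(1) by real_asymp
  then have "\<forall>\<^sub>F N::nat in sequentially. 1 / (\<alpha> * sqrt (real N)) < c"
    using assms(2) by (rule order_tendstoD)
  then have "\<forall>\<^sub>F N::nat in sequentially. N \<ge> 1 \<and> 1 / (\<alpha> * sqrt (real N)) < c"
    using eventually_ge_at_top[of "1::nat"] by eventually_elim simp
  then show thesis using that by (auto simp: eventually_sequentially)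
qed

theorem theorem3p6:
  fixes \<alpha> p :: real
  assumes "\<alpha> > 0" and "0 < p" and "p < 1"
  shows "(\<exists>N0::nat. \<forall>N\<ge>N0. \<forall>f. boolean_network N f \<and> cooperative N f \<longrightarrow>
            \<not> (\<exists>t::nat. t > 0 \<and>
                 measure_pmf.prob (init_flip_pmf N)
                   {(s, i). real (flip_distance N f s i t) \<ge> \<alpha> * real N} \<ge> p)) \<and>
         (\<forall>q::real. q > 0 \<longrightarrow>
            (\<exists>N1::nat. \<forall>N\<ge>N1. \<forall>f. boolean_network N f \<and> cooperative N f \<longrightarrow>
               \<not> decoherent p \<alpha> q N f))"
proof (intro conjI allI impI)
  obtain N0 :: nat where "\<And>N. N \<ge> N0 \<Longrightarrow> N \<ge> 1 \<and> 1 / (\<alpha> * sqrt (real N)) < p"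
    using eventually_inverse_sqrt_less assms by metis
  then show "\<exists>N0::nat. \<forall>N\<ge>N0. \<forall>f. boolean_network N f \<and> cooperative N f \<longrightarrow>
      \<not> (\<exists>t::nat. t > 0 \<and> measure_pmf.prob (init_flip_pmf N)
            {(s, i). real (flip_distance N f s i t) \<ge> \<alpha> * real N} \<ge> p)"
    using prob_flip_distance_le assms(1) by (meson dual_order.trans not_le)
next
  fix q :: real
  assume "q > 0"
  obtain N1 :: nat where "\<And>N. N \<ge> N1 \<Longrightarrow> N \<ge> 1 \<and> 1 / (\<alpha> * sqrt (real N)) < p * q"
    using eventually_inverse_sqrt_less[of \<alpha> "p * q"] assms \<open>q > 0\<close> by (metis mult_pos_pos)
  then show "\<exists>N1::nat. \<forall>N\<ge>N1. \<forall>f. boolean_network N f \<and> cooperative N f \<longrightarrow>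
      \<not> decoherent p \<alpha> q N f"
    using decoherent_imp_le assms(1) \<open>q > 0\<close> by (meson not_le)
qed

end
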